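(* Let $X$ and $Y$ be Markov processes with values in a metric space $S$ and with $X_0=Y_0=x_0$ for some $x_0\in S$. Let their transition operators $(T^X_{s,t})_{s\le t}$ and $(T^Y_{s,t})_{s\le t}$ be strongly continuous evolution systems on a Banach space $\mathbb{B}$ of real-valued functions on $S$, let $(A^{X+}_s)$ and $(A^{Y+}_s)$ be right generators of $X$ and $Y$ in the sense (defined in the context) of the space-time differentiation formula, and let $f\in\mathbb{B}$. For fixed $t\in\mathbb{R}_+$ assume that for all $s\le t$ the following holds: 1. the function $T^X_{\cdot,t}f:(s,x)\mapsto T^X_{s,t}f(x)$ belongs to $\mathcal{D}_+(A^{X+})\cap\mathcal{D}_+(A^{Y+})$; 2. $u\mapsto\frac{\partial^+}{\partial u}E[T^X_{u,t}f(X_u)\mid X_s]$ and $u\mapsto\frac{\partial^+}{\partial u}E[T^X_{u,t}f(Y_u)\mid Y_s]$ are integrable on $[0,t]$ (that is, on the part $u\ge s$ where they are defined); 3. $\operatorname{supp}(P^{Y_s})\subset\operatorname{supp}(P^{X_s})$; 4. $A^{X+}_sT^X_{s,t}f\ge A^{Y+}_sT^X_{s,t}f$ almost surely. Then $E[f(Y_t)]\le E[f(X_t)]$.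
   Context: The transition operators of a Markov process $X$ are $T^X_{s,t}f(x)=E[f(X_t)\mid X_s=x]$, $0\le s\le t$. The Banach space $\mathbb{B}$ is assumed to consist of functions integrable with respect to all the conditional laws of the processes, and to extend to a space of functions of the space-time processes. An evolution system on $\mathbb{B}$ is a family of bounded linear operators with $T_{s,s}=\mathrm{id}$ and $T_{s,u}=T_{s,t}T_{t,u}$ for $s\le t\le u$. It is strongly continuous if for every $f\in\mathbb{B}$ the $\mathbb{B}$-valued map $(s,t)\mapsto T_{s,t}f$ is continuous. $P^{X_s}$ is the law of $X_s$ and $\operatorname{supp}$ denotes its support. A family $(A^+_s)$ of linear operators on $\mathbb{B}$ with domains $\mathcal{D}(A^+_s)$ is regarded as a single operator on functions $g(s,x)$ of time and space by $(Ag)(s,x)=A^+_sg(s,\cdot)(x)$. Its domain $\mathcal{D}_+(A^+)$ consists of functions $g$ with $g(s,\cdot)\in\mathcal{D}(A^+_s)$ for all $s$ and for which the right time derivative $\frac{\partial^+}{\partial s}g$ exists. The family is a right generator of the Markov process $X$ if for all $g\in\mathcal{D}_+(A^+)$, all $x\in S$ and all $s\le u$, $$\frac{\partial^+}{\partial u}E[g(u,X_u)\mid X_s=x]=E\Big[\frac{\partial^+}{\partial u}g(u,X_u)+A^+_ug(u,\cdot)(X_u)\,\Big|\,X_s=x\Big],$$ where on the right-hand side $\frac{\partial^+}{\partial u}g(u,X_u)$ is the right partial derivative of $g$ in its time variable evaluated at $(u,X_u)$. Here $t$ is fixed and $T^X_{\cdot,t}f$ is a function on $[0,t]\times S$, so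 right derivatives in time are taken at times in $[0,t)$. The inequality in hypothesis 4 between functions on $S$ is understood almost surely after evaluation at $Y_s$, i.e. $P^{Y_s}$-almost everywhere.
   Formalization: The Banach space of functions is additionally assumed to have continuous point evaluations (norm convergence implies pointwise convergence); without this the claim can fail for spaces built with discontinuous linear functionals. *)

theory Defs
  imports "HOL-Probability.Probability"
begin

definition past :: "'m measure \<Rightarrow> (real \<Rightarrow> 'm \<Rightarrow> 'a::metric_space) \<Rightarrow> real \<Rightarrow> 'm measure" where
  "past M X s = sigma (space M) {X r -` B \<inter> space M | r B. 0 \<le> r \<and> r \<le> s \<and> B \<in> sets borel}"

text \<open>
  \<open>P s t x\<close> is the conditional law of \<open>X t\<close> given \<open>X s = x\<close>, defined for every state \<open>x\<close>; thus
  \<open>E[h(X\<^sub>t) | X\<^sub>s = x]\<close> is the integral of \<open>h\<close> with respect to \<open>P s t x\<close>.  The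
  Chapman-Kolmogorov equations are not required of the kernels here: for the functions under
  consideration they are part of the notion of an evolution system.
\<close>

definition markov_process ::
    "'m measure \<Rightarrow> (real \<Rightarrow> 'm \<Rightarrow> 'a::metric_space) \<Rightarrow> (real \<Rightarrow> real \<Rightarrow> 'a \<Rightarrow> 'a measure) \<Rightarrow> bool" where
  "markov_process M X P \<longleftrightarrow>
     prob_space M \<and>
     (\<forall>t\<ge>0. X t \<in> M \<rightarrow>\<^sub>M borel) \<and>
     (\<forall>s t. 0 \<le> s \<and> s \<le> t \<longrightarrow> P s t \<in> borel \<rightarrow>\<^sub>M prob_algebra borel) \<and>
     (\<forall>s x. 0 \<le> s \<longrightarrow> P s s x = return borel x) \<and>
     (\<forall>s t. \<forall>B\<in>sets borel. 0 \<le> s \<and> s \<le> t \<longrightarrow>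
        (AE w in M. real_cond_exp M (past M X s) (\<lambda>w. indicator B (X t w)) w
                      = measure (P s t (X s w)) B))"

definition msupp :: "'a::topological_space measure \<Rightarrow> 'a set" where
  "msupp \<mu> = {x. \<forall>U. open U \<and> x \<in> U \<longrightarrow> 0 < emeasure \<mu> U}"

text \<open>
  A Banach space of real-valued functions on \<open>'a\<close> is a Banach space \<open>'b\<close> together with an
  injective linear map \<open>val\<close> realising its elements as functions.  Norm convergence is required
  to imply pointwise convergence, i.e. the point evaluations are bounded.
\<close>

definition banach_function_space :: "('b::banach \<Rightarrow> 'a \<Rightarrow> real) \<Rightarrow> bool" where
  "banach_function_space val \<longleftrightarrow> inj val \<and> (\<forall>x. bounded_linear (\<lambda>f. val f x))"

definition transition_operators ::
    "('b::banach \<Rightarrow> 'a::metric_space \<Rightarrow> real) \<Rightarrow> (real \<Rightarrow> real \<Rightarrow> 'a \<Rightarrow> 'a measure)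
      \<Rightarrow> (real \<Rightarrow> real \<Rightarrow> 'b \<Rightarrow> 'b) \<Rightarrow> bool" where
  "transition_operators val P T \<longleftrightarrow>
     (\<forall>s t f x. 0 \<le> s \<and> s \<le> t \<longrightarrow>
        integrable (P s t x) (val f) \<and> val (T s t f) x = (LINT y|P s t x. val f y))"

definition evolution_system :: "(real \<Rightarrow> real \<Rightarrow> 'b::banach \<Rightarrow> 'b) \<Rightarrow> bool" where
  "evolution_system T \<longleftrightarrow>
     (\<forall>s t. 0 \<le> s \<and> s \<le> t \<longrightarrow> bounded_linear (T s t)) \<and>
     (\<forall>s\<ge>0. T s s = id) \<and>
     (\<forall>s t u. 0 \<le> s \<and> s \<le> t \<and> t \<le> u \<longrightarrow> T s u = T s t \<circ> T t u)"

definition strongly_continuous :: "(real \<Rightarrow> real \<Rightarrow> 'b::banach \<Rightarrow> 'b) \<Rightarrow> bool" where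
  "strongly_continuous T \<longleftrightarrow>
     (\<forall>f. continuous_on {(s, t). 0 \<le> s \<and> s \<le> t} (\<lambda>(s, t). T s t f))"

definition linear_operators :: "(real \<Rightarrow> 'b::banach set) \<Rightarrow> (real \<Rightarrow> 'b \<Rightarrow> 'b) \<Rightarrow> bool" where
  "linear_operators D A \<longleftrightarrow>
     (\<forall>s\<ge>0. subspace (D s) \<and>
        (\<forall>f\<in>D s. \<forall>h\<in>D s. A s (f + h) = A s f + A s h) \<and>
        (\<forall>c. \<forall>f\<in>D s. A s (c *\<^sub>R f) = c *\<^sub>R A s f))"

abbreviation right_derivative :: "(real \<Rightarrow> real) \<Rightarrow> real \<Rightarrow> real" where
  "right_derivative h u \<equiv> vector_derivative h (at_right u)"

text \<open>
  A function \<open>g(s, x)\<close> on \<open>[0, t] \<times> S\<close> all of whose sections \<open>g(s, \<cdot>)\<close> lie in the Banach space is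
  encoded as a map \<open>g :: real \<Rightarrow> 'b\<close> with \<open>g(s, x) = val (g s) x\<close>; its values outside \<open>[0, t]\<close> are
  irrelevant.  Time derivatives are taken pointwise in \<open>x\<close>.
\<close>

definition right_domain ::
    "('b::banach \<Rightarrow> 'a \<Rightarrow> real) \<Rightarrow> real \<Rightarrow> (real \<Rightarrow> 'b set) \<Rightarrow> (real \<Rightarrow> 'b) set" where
  "right_domain val t D =
     {g. (\<forall>s\<in>{0..t}. g s \<in> D s) \<and>
         (\<forall>s\<in>{0..<t}. \<forall>x. (\<lambda>r. val (g r) x) differentiable (at_right s))}"

definition right_generator ::
    "('b::banach \<Rightarrow> 'a::metric_space \<Rightarrow> real) \<Rightarrow> (real \<Rightarrow> real \<Rightarrow> 'a \<Rightarrow> 'a measure) \<Rightarrow> real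
      \<Rightarrow> (real \<Rightarrow> 'b set) \<Rightarrow> (real \<Rightarrow> 'b \<Rightarrow> 'b) \<Rightarrow> bool" where
  "right_generator val P t D A \<longleftrightarrow>
     linear_operators D A \<and>
     (\<forall>g\<in>right_domain val t D. \<forall>x s u. 0 \<le> s \<and> s \<le> u \<and> u < t \<longrightarrow>
        integrable (P s u x)
          (\<lambda>y. right_derivative (\<lambda>r. val (g r) y) u + val (A u (g u)) y) \<and>
        ((\<lambda>v. LINT y|P s v x. val (g v) y) has_real_derivative
           (LINT y|P s u x. right_derivative (\<lambda>r. val (g r) y) u + val (A u (g u)) y))
          (at_right u))"

end

theory Submission
  imports Defs
begin

text \<open>
  Put \<open>g\<^sub>u = T\<^sup>X\<^sub>u\<^sub>t f\<close>. By the evolution property \<open>E[g\<^sub>v(X\<^sub>v) | X\<^sub>u = x]\<close> does not depend on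
  \<open>v \<in> [u, t]\<close>, so the generator formula of \<open>X\<close> at \<open>v = u\<close> is the backward equation
  \<open>\<partial>\<^sup>+g\<^sub>u = - A\<^sup>X\<^sub>u g\<^sub>u\<close> at every point. Inserting it into the generator formula of \<open>Y\<close>, the function
  \<open>\<phi>(u) = E[g\<^sub>u(Y\<^sub>u) | Y\<^sub>0 = x\<^sub>0]\<close> has right derivative \<open>E[(A\<^sup>Y\<^sub>u - A\<^sup>X\<^sub>u) g\<^sub>u(Y\<^sub>u)] \<le> 0\<close>. By the uniform
  boundedness principle \<open>\<phi>\<close> is continuous up to and including \<open>t\<close>, hence
  \<open>E[f(Y\<^sub>t)] = \<phi>(t) \<le> \<phi>(0) = E[f(X\<^sub>t)]\<close>.
\<close>

section \<open>Monotonicity from right derivatives\<close>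

text \<open>With right derivatives only, the usual mean value theorem does not apply. Instead, for
  each slope \<open>e > 0\<close>, take the last point at which the graph is not above the line of
  slope \<open>e\<close> through \<open>(a, \<phi> a)\<close>. The right derivative there is less
  than \<open>e\<close>, so the graph stays below a little longer, unless that point is
  \<open>b\<close>. Then \<open>e\<close> tends to 0.\<close>

lemma right_derivative_nonpos_imp_le:
  fixes \<phi> :: "real \<Rightarrow> real"
  assumes "a \<le> b" and cont: "continuous_on {a..b} \<phi>"
    and der: "\<And>u. a \<le> u \<Longrightarrow> u < b \<Longrightarrow> \<exists>d\<le>0. (\<phi> has_real_derivative d) (at_right u)"
  shows "\<phi> b \<le> \<phi> a"
proof -
  have *: "\<phi> b \<le> \<phi> a + e * (b - a)" if "e > 0" for e
  proof (rule ccontr)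
    assume neg: "\<not> \<phi> b \<le> \<phi> a + e * (b - a)"
    define \<psi> where "\<psi> u = \<phi> u - \<phi> a - e * (u - a)" for u
    define S where "S = {u \<in> {a..b}. \<psi> u \<le> 0}"
    have "continuous_on {a..b} \<psi>"
      unfolding \<psi>_def by (intro continuous_intros cont)
    then have "closed S"
      unfolding S_def by (intro continuous_on_closed_Collect_le continuous_on_const closed_atLeastAtMost)
    then have "compact S"
      by (auto simp: S_def compact_eq_bounded_closed intro: bounded_subset[of "{a..b}"])
    moreover have "a \<in> S" using \<open>a \<le> b\<close> by (simp add: S_def \<psi>_def)
    ultimately obtain c where c: "c \<in> S" and max: "\<And>u. u \<in> S \<Longrightarrow> u \<le> c"
      using compact_attains_sup[of S] by blast
    \<comment> \<open>By \<open>neg\<close>, \<open>\<psi> b > 0\<close>, so \<open>b\<close> lies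
      outside \<open>S\<close>.\<close>
    have "c < b" using c neg by (cases "c = b") (auto simp: S_def \<psi>_def)
    then obtain d where d: "d \<le> 0" "(\<phi> has_real_derivative d) (at_right c)"
      using der[of c] c by (auto simp: S_def)
    have "(\<psi> has_real_derivative d - e) (at_right c)"
      unfolding \<psi>_def by (auto intro!: derivative_eq_intros d)
    with has_real_derivative_neg_dec_right[of \<psi> "d - e" c "{c<..}"] d \<open>e > 0\<close>
    obtain k where k: "k > 0" "\<And>h. h > 0 \<Longrightarrow> h < k \<Longrightarrow> \<psi> c > \<psi> (c + h)"
      by auto
    \<comment> \<open>The cap \<open>b - c\<close> keeps \<open>c + h\<close> in
      \<open>{a..b}\<close>; halving \<open>k\<close> makes \<open>h < k\<close> strict.\<close>
    define h where "h = min (k / 2) (b - c)"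
    have h: "h > 0" "h < k" "c + h \<le> b" using k(1) \<open>c < b\<close> by (auto simp: h_def)
    with k(2)[of h] c have "c + h \<in> S" by (auto simp: S_def)
    with max h(1) show False by fastforce
  qed
  show ?thesis
  proof (cases "a = b")
    case False
    with \<open>a \<le> b\<close> have "b - a > 0" by simp
    show ?thesis
    proof (rule field_le_epsilon)
      fix e :: real assume "e > 0"
      with *[of "e / (b - a)"] \<open>b - a > 0\<close> show "\<phi> b \<le> \<phi> a + e" by simp
    qed
  qed simp
qed

section \<open>Uniform boundedness and strong continuity\<close>

text \<open>The Baire category theorem, carried over from abstract metric spaces to the type class
  topology.\<close>

lemma interior_UN_closed_empty:
  fixes F :: "nat \<Rightarrow> 'b::banach set"
  assumes "\<And>n. closed (F n)" "\<And>n. interior (F n) = {}"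
  shows "interior (\<Union>n. F n) = {}"
proof -
  have "Met_TC.mtopology interior_of \<Union>(range F) = {}"
  proof (rule Met_TC.metric_Baire_category_alt)
    show "Metric_space.mcomplete UNIV (dist :: 'b \<Rightarrow> _)"
      using complete_UNIV by simp
  qed (use assms in \<open>auto\<close>)
  then show ?thesis by simp
qed

text \<open>The Banach-Steinhaus theorem. The closed sets \<open>F n\<close> cover the space, so by
  Baire one of them contains a ball; linearity moves the bound from that ball to the origin.\<close>

lemma pointwise_bounded_imp_norm_bounded:
  fixes L :: "'i \<Rightarrow> 'b::banach \<Rightarrow> 'c::real_normed_vector"
  assumes lin: "\<And>i. i \<in> I \<Longrightarrow> bounded_linear (L i)"
    and bdd: "\<And>x. \<exists>C. \<forall>i\<in>I. norm (L i x) \<le> C"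
  obtains C where "C > 0" "\<And>i x. i \<in> I \<Longrightarrow> norm (L i x) \<le> C * norm x"
proof -
  define F where "F n = {x. \<forall>i\<in>I. norm (L i x) \<le> real n}" for n :: nat
  have closed: "closed (F n)" for n
  proof -
    have "F n = (\<Inter>i\<in>I. {x. norm (L i x) \<le> real n})" by (auto simp: F_def)
    moreover have "closed {x. norm (L i x) \<le> real n}" if "i \<in> I" for i
      using lin[OF that]
      by (intro closed_Collect_le continuous_intros) (rule linear_continuous_on)
    ultimately show ?thesis by auto
  qed
  have "\<exists>n. interior (F n) \<noteq> {}"
  proof (rule ccontr)
    assume "\<nexists>n. interior (F n) \<noteq> {}"
    then have "interior (F n) = {}" for n by blast
    then have "interior (\<Union>n. F n) = {}" by (rule interior_UN_closed_empty[OF closed])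
    moreover have "\<Union>(range F) = UNIV"
    proof -
      have "\<exists>n. x \<in> F n" for x
      proof -
        obtain C where "\<forall>i\<in>I. norm (L i x) \<le> C" using bdd by blast
        moreover obtain n where "C \<le> real n" using real_arch_simple by blast
        ultimately show ?thesis unfolding F_def by (blast intro: order_trans)
      qed
      then show ?thesis by blast
    qed
    ultimately show False by simp
  qed
  then obtain n z where "z \<in> interior (F n)" by blast
  then obtain r where "r > 0" and ball: "cball z r \<subseteq> F n"
    by (meson mem_interior_cball)
  show ?thesis
  \<comment> \<open>If \<open>norm y = r\<close>, then \<open>L i y = L i (z + y) - L i z\<close>
    has norm at most \<open>2 * n\<close>. The added 1 keeps the constant positive when
    \<open>n = 0\<close>.\<close>
  proof (rule that[of "(2 * real n + 1) / r"])
    show "(2 * real n + 1) / r > 0" using \<open>r > 0\<close> by simp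
    fix i x assume i: "i \<in> I"
    interpret bounded_linear "L i" by (rule lin[OF i])
    show "norm (L i x) \<le> (2 * real n + 1) / r * norm x"
    proof (cases "x = 0")
      case True
      then show ?thesis by simp
    next
      case False
      define y where "y = (r / norm x) *\<^sub>R x"
      have "norm y = r" using False \<open>r > 0\<close> by (simp add: y_def)
      then have "z + y \<in> F n" "z \<in> F n"
        using ball \<open>r > 0\<close> by (auto simp: dist_norm subset_iff)
      then have "norm (L i (z + y)) \<le> n" "norm (L i z) \<le> n" using i by (auto simp: F_def)
      moreover have "norm (L i y) \<le> norm (L i (z + y)) + norm (L i z)"
        using norm_triangle_ineq4[of "L i (z + y)" "L i z"] by (simp add: add)
      ultimately have "norm (L i y) \<le> 2 * real n + 1" by linarith
      moreover have "norm (L i y) = r / norm x * norm (L i x)"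
        using \<open>r > 0\<close> by (simp add: y_def scaleR)
      ultimately show ?thesis using False \<open>r > 0\<close> by (simp add: field_simps)
    qed
  qed
qed

text \<open>Strong continuity treats a fixed argument only. For a moving one, split
  \<open>L u (g u) = L u (g u - g a) + L u (g a)\<close>; the first term vanishes in the limit
  because the operators are uniformly bounded on the compact set \<open>K\<close>.\<close>

lemma continuous_on_strong_apply:
  fixes L :: "'i::topological_space \<Rightarrow> 'b::banach \<Rightarrow> 'c::real_normed_vector"
  assumes "compact K" and lin: "\<And>u. u \<in> K \<Longrightarrow> bounded_linear (L u)"
    and strong: "\<And>h. continuous_on K (\<lambda>u. L u h)" and g: "continuous_on K g"
  shows "continuous_on K (\<lambda>u. L u (g u))"
proof -
  \<comment> \<open>For fixed \<open>h\<close> the orbit is a continuous image of \<open>K\<close>,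
    hence bounded.\<close>
  have "\<exists>C. \<forall>u\<in>K. norm (L u h) \<le> C" for h
    using compact_imp_bounded[OF compact_continuous_image[OF strong \<open>compact K\<close>], of h]
    by (auto simp: bounded_iff)
  with lin obtain C where C: "\<And>u x. u \<in> K \<Longrightarrow> norm (L u x) \<le> C * norm x"
    using pointwise_bounded_imp_norm_bounded[of K L] by metis
  show ?thesis
    unfolding continuous_on_def
  proof
    fix a assume a: "a \<in> K"
    have "((\<lambda>u. C * norm (g u - g a)) \<longlongrightarrow> C * norm (g a - g a)) (at a within K)"
      using g a unfolding continuous_on_def by (intro tendsto_intros) auto
    then have "((\<lambda>u. L u (g u - g a)) \<longlongrightarrow> 0) (at a within K)"
      by (intro Lim_null_comparison[of "\<lambda>u. L u (g u - g a)" "\<lambda>u. C * norm (g u - g a)"])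
        (auto simp: eventually_at_filter C)
    moreover have "((\<lambda>u. L u (g a)) \<longlongrightarrow> L a (g a)) (at a within K)"
      using strong a unfolding continuous_on_def by blast
    ultimately have "((\<lambda>u. L u (g u - g a) + L u (g a)) \<longlongrightarrow> L a (g a)) (at a within K)"
      using tendsto_add by fastforce
    moreover have "\<forall>\<^sub>F u in at a within K. L u (g u - g a) + L u (g a) = L u (g u)"
      using lin by (auto simp: eventually_at_filter bounded_linear.linear linear_diff)
    ultimately show "((\<lambda>u. L u (g u)) \<longlongrightarrow> L a (g a)) (at a within K)"
      by (rule Lim_transform_eventually)
  qed
qed

lemma strongly_continuous_compose:
  assumes "strongly_continuous T" "continuous_on K p" "continuous_on K q"
    and "\<And>u. u \<in> K \<Longrightarrow> 0 \<le> p u \<and> p u \<le> q u"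
  shows "continuous_on K (\<lambda>u. T (p u) (q u) h)"
proof -
  have "continuous_on {(s, t). 0 \<le> s \<and> s \<le> t} (\<lambda>(s, t). T s t h)"
    using assms(1) by (simp add: strongly_continuous_def)
  then have "continuous_on K (\<lambda>u. (\<lambda>(s, t). T s t h) (p u, q u))"
    by (rule continuous_on_compose2) (use assms in \<open>auto intro: continuous_on_Pair\<close>)
  then show ?thesis by simp
qed

section \<open>Laws of the processes and transition kernels\<close>

lemma markov_kernel_borel_prob:
  assumes "markov_process M X P" "0 \<le> s" "s \<le> t"
  shows "sets (P s t x) = sets borel" "prob_space (P s t x)"
proof -
  have "P s t \<in> borel \<rightarrow>\<^sub>M prob_algebra borel"
    using assms by (simp add: markov_process_def)
  from measurable_space[OF this, of x]
  show "sets (P s t x) = sets borel" "prob_space (P s t x)"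
    by (auto simp: space_prob_algebra)
qed

text \<open>Because the start is almost surely \<open>x0\<close>, the conditional probability of
  \<open>X t\<close> lying in \<open>B\<close> given the past at time 0 is almost surely the
  constant \<open>measure (P 0 t x0) B\<close>. Its mean is the unconditional probability.\<close>

lemma distr_eq_markov_kernel:
  assumes mp: "markov_process M X P" and start: "AE w in M. X 0 w = x0" and "0 \<le> t"
  shows "distr M borel (X t) = P 0 t x0"
proof -
  interpret prob_space M using mp by (simp add: markov_process_def)
  have X: "X r \<in> M \<rightarrow>\<^sub>M borel" if "r \<ge> 0" for r using mp that by (simp add: markov_process_def)
  note [measurable] = X[OF \<open>0 \<le> t\<close>]
  interpret K: prob_space "P 0 t x0" using markov_kernel_borel_prob[OF mp] \<open>0 \<le> t\<close> by blast
  interpret D: prob_space "distr M borel (X t)" by (rule prob_space_distr) measurable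
  have "subalgebra M (past M X 0)"
    unfolding subalgebra_def past_def
    by (auto intro!: sets.sigma_sets_subset measurable_sets[OF X] simp: sets_measure_of_conv)
  then interpret finite_measure_subalgebra M "past M X 0" by unfold_locales
  show ?thesis
  proof (rule measure_eqI)
    show sets: "sets (distr M borel (X t)) = sets (P 0 t x0)"
      using markov_kernel_borel_prob[OF mp] \<open>0 \<le> t\<close> by simp
    fix B assume "B \<in> sets (distr M borel (X t))"
    then have B [measurable]: "B \<in> sets borel" by simp
    have "AE w in M. real_cond_exp M (past M X 0) (\<lambda>w. indicator B (X t w)) w
        = measure (P 0 t (X 0 w)) B"
      using mp B \<open>0 \<le> t\<close> by (simp add: markov_process_def)
    with start have "AE w in M. real_cond_exp M (past M X 0) (\<lambda>w. indicator B (X t w)) w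
        = measure (P 0 t x0) B"
      by eventually_elim simp
    then have "(LINT w|M. real_cond_exp M (past M X 0) (\<lambda>w. indicator B (X t w)) w)
        = (LINT w|M. measure (P 0 t x0) B)"
      by (intro integral_cong_AE) auto
    moreover have "integrable M (\<lambda>w. indicator B (X t w) :: real)"
      by (rule integrable_const_bound[where B = 1]) auto
    ultimately have "(LINT w|M. indicator B (X t w)) = measure (P 0 t x0) B"
      by (simp add: real_cond_exp_int(2) prob_space)
    moreover have "(LINT w|M. indicator B (X t w)) = measure (distr M borel (X t)) B"
      using integral_distr[of "X t" M borel "indicator B :: _ \<Rightarrow> real"] by simp
    ultimately show "emeasure (distr M borel (X t)) B = emeasure (P 0 t x0) B"
      by (simp add: D.emeasure_eq_measure K.emeasure_eq_measure)
  qed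
qed

lemma expectation_eq_transition:
  assumes mp: "markov_process M X P" and start: "AE w in M. X 0 w = x0"
    and T: "transition_operators val P T" and "0 \<le> t"
  shows "(LINT w|M. val h (X t w)) = val (T 0 t h) x0"
proof -
  have "integrable (P 0 t x0) (val h)" and T0: "val (T 0 t h) x0 = (LINT y|P 0 t x0. val h y)"
    using T \<open>0 \<le> t\<close> by (auto simp: transition_operators_def)
  \<comment> \<open>Integrability against a kernel on the Borel sets contains Borel measurability of
    \<open>val h\<close>.\<close>
  then have [measurable]: "val h \<in> borel_measurable borel"
    using measurable_cong_sets[OF markov_kernel_borel_prob(1)[OF mp order_refl \<open>0 \<le> t\<close>] refl]
    by (metis borel_measurable_integrable)
  have [measurable]: "X t \<in> M \<rightarrow>\<^sub>M borel" using mp \<open>0 \<le> t\<close> by (simp add: markov_process_def)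
  show ?thesis
    unfolding T0 distr_eq_markov_kernel[OF mp start \<open>0 \<le> t\<close>, symmetric]
    by (simp add: integral_distr)
qed

section \<open>Right generators and the backward equation\<close>

lemma right_generatorD:
  assumes "right_generator val P t D A" "g \<in> right_domain val t D" "0 \<le> s" "s \<le> u" "u < t"
  defines "k \<equiv> \<lambda>y. right_derivative (\<lambda>r. val (g r) y) u + val (A u (g u)) y"
  shows "integrable (P s u x) k"
    and "((\<lambda>v. LINT y|P s v x. val (g v) y) has_real_derivative (LINT y|P s u x. k y)) (at_right u)"
  using assms(1-5) unfolding right_generator_def k_def by blast+

text \<open>At \<open>s = u\<close> the kernel is a Dirac mass, so the generator formula becomes
  pointwise. As it holds at every state, it can be used under the law of the other process.\<close>

lemma backward_equation:
  assumes mp: "markov_process M X P" and T: "transition_operators val P T"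
    and ev: "evolution_system T" and gen: "right_generator val P t D A"
    and dom: "(\<lambda>s. T s t f) \<in> right_domain val t D" and "0 \<le> u" "u < t"
  shows "right_derivative (\<lambda>r. val (T r t f) x) u + val (A u (T u t f)) x = 0"
proof -
  define k where "k = (\<lambda>y. right_derivative (\<lambda>r. val (T r t f) y) u + val (A u (T u t f)) y)"
  have ret: "P u u x = return borel x" using mp \<open>0 \<le> u\<close> by (simp add: markov_process_def)
  have "integrable (P u u x) k"
    and der: "((\<lambda>v. LINT y|P u v x. val (T v t f) y) has_real_derivative (LINT y|P u u x. k y))
      (at_right u)"
    unfolding k_def by (rule right_generatorD[OF gen dom \<open>0 \<le> u\<close> order_refl \<open>u < t\<close>])+
  then have "k \<in> borel_measurable borel"
    unfolding ret using borel_measurable_integrable by fastforce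
  then have "(LINT y|P u u x. k y) = k x" unfolding ret by (simp add: integral_return)
  with der have der: "((\<lambda>v. LINT y|P u v x. val (T v t f) y) has_real_derivative k x) (at_right u)"
    by simp
  have const: "(LINT y|P u v x. val (T v t f) y) = val (T u t f) x" if "u \<le> v" "v \<le> t" for v
  proof -
    have "(LINT y|P u v x. val (T v t f) y) = val (T u v (T v t f)) x"
      using T that \<open>0 \<le> u\<close> unfolding transition_operators_def by metis
    also have "T u v (T v t f) = T u t f"
      using ev that \<open>0 \<le> u\<close> by (simp add: evolution_system_def)
    finally show ?thesis .
  qed
  \<comment> \<open>Constancy is known on \<open>{u..t}\<close> only; since \<open>u < t\<close>,
    this contains a right neighbourhood of \<open>u\<close>.\<close>
  have "\<forall>\<^sub>F v in at_right u. (LINT y|P u v x. val (T v t f) y) = val (T u t f) x"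
    using eventually_at_right_less[of u] eventually_at_right_real[OF \<open>u < t\<close>]
    by eventually_elim (auto intro: const)
  with der have "((\<lambda>v. val (T u t f) x) has_real_derivative k x) (at_right u)"
    using const[of u] \<open>u < t\<close> by (subst (asm) has_field_derivative_cong_eventually) auto
  then have "k x = 0"
    by (intro vector_derivative_unique_within[OF trivial_limit_at_right_real _ has_vector_derivative_const])
      (simp add: has_real_derivative_iff_has_vector_derivative)
  then show ?thesis by (simp add: k_def)
qed

section \<open>Comparison of the two processes\<close>

theorem theorem2p8:
  fixes M :: "'m measure" and N :: "'n measure"
    and X :: "real \<Rightarrow> 'm \<Rightarrow> 'a::metric_space" and Y :: "real \<Rightarrow> 'n \<Rightarrow> 'a"
    and PX PY :: "real \<Rightarrow> real \<Rightarrow> 'a \<Rightarrow> 'a measure"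
    and x0 :: 'a
    and val :: "'b::banach \<Rightarrow> 'a \<Rightarrow> real"
    and TX TY :: "real \<Rightarrow> real \<Rightarrow> 'b \<Rightarrow> 'b"
    and DX DY :: "real \<Rightarrow> 'b set" and AX AY :: "real \<Rightarrow> 'b \<Rightarrow> 'b"
    and f :: 'b and t :: real
  assumes "markov_process M X PX" and "markov_process N Y PY"
    and "AE w in M. X 0 w = x0" and "AE w in N. Y 0 w = x0"
    and "banach_function_space val"
    and "transition_operators val PX TX" and "transition_operators val PY TY"
    and "evolution_system TX" and "strongly_continuous TX"
    and "evolution_system TY" and "strongly_continuous TY"
    and "0 \<le> t"
    and "right_generator val PX t DX AX" and "right_generator val PY t DY AY"
    and "(\<lambda>s. TX s t f) \<in> right_domain val t DX \<inter> right_domain val t DY"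
    and "\<And>s. 0 \<le> s \<Longrightarrow> s \<le> t \<Longrightarrow>
           AE w in M. set_integrable lebesgue {s..<t}
             (\<lambda>u. right_derivative (\<lambda>v. LINT y|PX s v (X s w). val (TX v t f) y) u)"
    and "\<And>s. 0 \<le> s \<Longrightarrow> s \<le> t \<Longrightarrow>
           AE w in N. set_integrable lebesgue {s..<t}
             (\<lambda>u. right_derivative (\<lambda>v. LINT y|PY s v (Y s w). val (TX v t f) y) u)"
    and "\<And>s. 0 \<le> s \<Longrightarrow> s \<le> t \<Longrightarrow> msupp (distr N borel (Y s)) \<subseteq> msupp (distr M borel (X s))"
    and "\<And>s. 0 \<le> s \<Longrightarrow> s \<le> t \<Longrightarrow>
           AE y in distr N borel (Y s). val (AY s (TX s t f)) y \<le> val (AX s (TX s t f)) y"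
  shows "(LINT w|N. val f (Y t w)) \<le> (LINT w|M. val f (X t w))"
proof -
  define \<phi> where "\<phi> u = (LINT y|PY 0 u x0. val (TX u t f) y)" for u
  have \<phi>: "\<phi> u = val (TY 0 u (TX u t f)) x0" if "0 \<le> u" for u
    using assms(7) that by (simp add: \<phi>_def transition_operators_def)
  note domX = IntD1[OF assms(15)] and domY = IntD2[OF assms(15)]
  have lin: "bounded_linear (\<lambda>h. val h x0)"
    using assms(5) by (simp add: banach_function_space_def)
  \<comment> \<open>The endpoint \<open>t\<close> matters: the derivative formula covers
    \<open>u < t\<close> only, and continuity carries the inequality to \<open>t\<close>.\<close>
  have "continuous_on {0..t} (\<lambda>u. TY 0 u (TX u t f))"
  proof (rule continuous_on_strong_apply[where L = "TY 0"])
    show "bounded_linear (TY 0 u)" if "u \<in> {0..t}" for u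
      using assms(10) that by (simp add: evolution_system_def)
    show "continuous_on {0..t} (\<lambda>u. TY 0 u h)" for h
      by (rule strongly_continuous_compose[OF assms(11)]) auto
    show "continuous_on {0..t} (\<lambda>u. TX u t f)"
      by (rule strongly_continuous_compose[OF assms(9)]) auto
  qed simp
  then have "continuous_on {0..t} (\<lambda>u. val (TY 0 u (TX u t f)) x0)"
    by (rule bounded_linear.continuous_on[OF lin])
  then have cont: "continuous_on {0..t} \<phi>"
    by (subst continuous_on_cong[OF refl \<phi>]) auto
  have "\<phi> t \<le> \<phi> 0"
  proof (rule right_derivative_nonpos_imp_le[OF \<open>0 \<le> t\<close> cont])
    fix u assume u: "0 \<le> u" "u < t"
    define k where
      "k = (\<lambda>y. right_derivative (\<lambda>r. val (TX r t f) y) u + val (AY u (TX u t f)) y)"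
    have "(\<phi> has_real_derivative (LINT y|PY 0 u x0. k y)) (at_right u)"
      unfolding \<phi>_def k_def by (rule right_generatorD(2)[OF assms(14) domY order_refl u])
    \<comment> \<open>The law of \<open>Y u\<close> is \<open>PY 0 u x0\<close>, so the almost sure
      inequality holds under the kernel.\<close>
    moreover have "AE y in PY 0 u x0. val (AY u (TX u t f)) y \<le> val (AX u (TX u t f)) y"
      using assms(19)[of u] u unfolding distr_eq_markov_kernel[OF assms(2,4) u(1)] by simp
    \<comment> \<open>By the backward equation of \<open>X\<close>, \<open>k\<close> is the
      difference of \<open>AY u\<close> and \<open>AX u\<close> applied to
      \<open>TX u t f\<close>.\<close>
    then have "AE y in PY 0 u x0. 0 \<le> - k y"
    proof eventually_elim
      case (elim y)
      with backward_equation[OF assms(1,6,8,13) domX u, of y] show ?case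
        unfolding k_def by linarith
    qed
    then have "0 \<le> (LINT y|PY 0 u x0. - k y)" by (rule integral_nonneg_AE)
    then have "(LINT y|PY 0 u x0. k y) \<le> 0" by simp
    ultimately show "\<exists>d\<le>0. (\<phi> has_real_derivative d) (at_right u)" by blast
  qed
  \<comment> \<open>\<open>TY 0 0 = id\<close> leaves \<open>TX 0 t f\<close> at
    \<open>x0\<close>.\<close>
  moreover have "\<phi> 0 = (LINT w|M. val f (X t w))"
    using expectation_eq_transition[OF assms(1,3,6,12)] assms(10)
    by (simp add: \<phi> evolution_system_def)
  \<comment> \<open>\<open>TX t t = id\<close> leaves \<open>TY 0 t f\<close> at
    \<open>x0\<close>.\<close>
  moreover have "\<phi> t = (LINT w|N. val f (Y t w))"
    using expectation_eq_transition[OF assms(2,4,7,12)] assms(8) \<open>0 \<le> t\<close>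
    by (simp add: \<phi> evolution_system_def)
  ultimately show ?thesis by simp
qed

end
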